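(* Let $S\neq\mathbb{N}$ be a numerical semigroup and let $a\in S$. Then the minimal generators of the dilatation $T=S+a$ are exactly the elements of the set \begin{gather*} \{e(S)+2a\}\,\cup\,\{\alpha+a \mid \alpha\in \mathrm{Ap}(S,e(S))\setminus\{0\} \text{ and } \alpha-a\notin S\setminus(\Gamma(S)\cup\{0\})\}\,\cup\\ \cup\,\{\beta+e(S)+a \mid \beta\in \mathrm{Ap}(S,a) \text{ and } \beta+e(S)-a\notin S\setminus(\Gamma(S)\cup\{0\})\}. \end{gather*}
   Context: $\mathbb{N}$ denotes the nonnegative integers. A numerical semigroup $S$ is a submonoid of $(\mathbb{N},+)$ with $\mathbb{N}\setminus S$ finite. For $a\in S$, the dilatation of $S$ with respect to $a$ is the numerical semigroup $S+a=\{0\}\cup\{s+a : s\in S\setminus\{0\}\}$ (so here $S+a$ is not the full translate of $S$). The multiplicity $e(S)$ is the smallest positive element of $S$, and $\Gamma(S)$ is the unique minimal set of generators of $S$ as a monoid. For $s\in S$, $\mathrm{Ap}(S,s)=\{x\in S : x-s\notin S\}$ (in particular $\mathrm{Ap}(S,0)=\emptyset$). *)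

theory Defs
  imports Main HOL.Hull
begin

definition add_submonoid :: "nat set \<Rightarrow> bool" where
  "add_submonoid M \<longleftrightarrow> 0 \<in> M \<and> (\<forall>x\<in>M. \<forall>y\<in>M. x + y \<in> M)"

definition numerical_semigroup :: "nat set \<Rightarrow> bool" where
  "numerical_semigroup S \<longleftrightarrow> add_submonoid S \<and> finite (UNIV - S)"

definition dilatation :: "nat set \<Rightarrow> nat \<Rightarrow> nat set" where
  "dilatation S a = {0} \<union> {s + a | s. s \<in> S - {0}}"

definition semigroup_mult :: "nat set \<Rightarrow> nat" where
  "semigroup_mult S = (LEAST n. n \<in> S \<and> 0 < n)"

text \<open>\<open>add_submonoid hull A\<close> is the submonoid generated by \<open>A\<close>; minimality is with
  respect to inclusion.\<close>

definition is_minimal_generating_set :: "nat set \<Rightarrow> nat set \<Rightarrow> bool" where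
  "is_minimal_generating_set A S \<longleftrightarrow>
     add_submonoid hull A = S \<and> (\<forall>B. B \<subset> A \<longrightarrow> add_submonoid hull B \<noteq> S)"

text \<open>The description is proper for every submonoid of the naturals, see
  \<open>ex1_minimal_generating_set\<close> below.\<close>

definition minimal_generators :: "nat set \<Rightarrow> nat set" where
  "minimal_generators S = (THE A. is_minimal_generating_set A S)"

text \<open>The difference is taken in the integers, since subtraction on the naturals truncates:
  a negative difference is never an element of \<open>S\<close>.\<close>

definition Apery :: "nat set \<Rightarrow> nat \<Rightarrow> nat set" where
  "Apery S s = {x \<in> S. int x - int s \<notin> int ` S}"

lemma ex1_minimal_generating_set:
  assumes S: "add_submonoid S"
  shows "\<exists>!A. is_minimal_generating_set A S"
proof -
  define I where "I = {x \<in> S. x \<noteq> 0 \<and> (\<forall>y\<in>S - {0}. \<forall>z\<in>S - {0}. x \<noteq> y + z)}"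
  have sub: "add_submonoid (add_submonoid hull A)" for A
    by (rule hull_in) (auto simp: add_submonoid_def)
  have sub_0: "0 \<in> add_submonoid hull A" for A
    using sub[of A] unfolding add_submonoid_def[of "add_submonoid hull A"] by (rule conjunct1)
  have sub_add: "x + y \<in> add_submonoid hull A"
    if "x \<in> add_submonoid hull A" "y \<in> add_submonoid hull A" for A x y
    using sub[of A] that unfolding add_submonoid_def[of "add_submonoid hull A"] by blast
  have I_sub: "I \<subseteq> A" if A: "add_submonoid hull A = S" for A
  proof
    fix x assume x: "x \<in> I"
    show "x \<in> A"
    proof (rule ccontr)
      assume "x \<notin> A"
      moreover have "A \<subseteq> S" using A hull_subset by metis
      ultimately have "A \<subseteq> S - {x}" by auto
      moreover have "add_submonoid (S - {x})"
        unfolding add_submonoid_def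
      proof (intro conjI ballI)
        show "0 \<in> S - {x}" using S x by (auto simp: add_submonoid_def I_def)
      next
        fix y z assume yz: "y \<in> S - {x}" "z \<in> S - {x}"
        have "y + z \<noteq> x"
        proof
          assume e: "y + z = x"
          with yz have "y \<noteq> 0" "z \<noteq> 0" by auto
          with e yz x show False by (auto simp: I_def)
        qed
        with yz S show "y + z \<in> S - {x}" by (auto simp: add_submonoid_def)
      qed
      ultimately have "add_submonoid hull A \<subseteq> S - {x}" by (rule hull_minimal)
      with A x show False by (auto simp: I_def)
    qed
  qed
  have "x \<in> add_submonoid hull I" if "x \<in> S" for x
    using that
  proof (induction x rule: less_induct)
    case (less x)
    consider "x = 0" | "x \<in> I" | y z where "y \<in> S - {0}" "z \<in> S - {0}" "x = y + z"
      using less.prems unfolding I_def by blast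
    then show ?case
    proof cases
      case 1
      then show ?thesis by (simp add: sub_0)
    next
      case 2
      then show ?thesis by (rule hull_inc)
    next
      case 3
      then have "y < x" "z < x" "y \<in> S" "z \<in> S" by auto
      then have "y \<in> add_submonoid hull I" "z \<in> add_submonoid hull I"
        using less.IH by blast+
      then show ?thesis unfolding \<open>x = y + z\<close> by (rule sub_add)
    qed
  qed
  moreover have "add_submonoid hull I \<subseteq> S"
    by (rule hull_minimal) (auto simp: I_def S)
  ultimately have gen: "add_submonoid hull I = S" by auto
  show ?thesis
  proof (rule ex1I)
    have "add_submonoid hull B \<noteq> S" if "B \<subset> I" for B
      using I_sub[of B] that by blast
    then show "is_minimal_generating_set I S"
      using gen unfolding is_minimal_generating_set_def by simp
  next
    fix A assume A: "is_minimal_generating_set A S"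
    then have "I \<subseteq> A" using I_sub unfolding is_minimal_generating_set_def by simp
    moreover have "\<not> I \<subset> A" using A gen unfolding is_minimal_generating_set_def by metis
    ultimately show "A = I" by (simp add: psubset_eq)
  qed
qed

end

theory Submission
  imports Defs
begin

text \<open>
  The minimal generators of a submonoid of the naturals are its nonzero elements that are not a
  sum of two nonzero elements. A sum of two nonzero elements of \<open>S + a\<close> has the form
  \<open>(y + z + a) + a\<close> with \<open>y, z \<in> S - {0}\<close>, so \<open>s + a\<close> is a minimal generator of \<open>S + a\<close> iff
  \<open>s - a\<close> is not a sum of two nonzero elements of \<open>S\<close>. Writing \<open>e\<close> for the multiplicity, either
  \<open>s \<in> Ap(S, e)\<close>, or \<open>s = \<beta> + e\<close> with \<open>\<beta> \<in> Ap(S, a)\<close>, or \<open>s = \<gamma> + a + e\<close> with \<open>\<gamma> \<in> S\<close>; in the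
  last case \<open>s - a = \<gamma> + e\<close>, which forces \<open>\<gamma> = 0\<close>.
\<close>

lemma add_submonoid_zero: "add_submonoid M \<Longrightarrow> 0 \<in> M"
  by (simp add: add_submonoid_def)

lemma add_submonoid_add: "add_submonoid M \<Longrightarrow> x \<in> M \<Longrightarrow> y \<in> M \<Longrightarrow> x + y \<in> M"
  by (simp add: add_submonoid_def)

lemma add_submonoid_hull: "add_submonoid (add_submonoid hull A)"
  by (rule hull_in) (auto simp: add_submonoid_def)

text \<open>Removing an irreducible \<open>x\<close> from \<open>S\<close> leaves a submonoid, so
  generators that avoid \<open>x\<close> never produce \<open>x\<close>.\<close>

lemma irreducible_in_generating_set:
  assumes S: "add_submonoid S" and gen: "add_submonoid hull A = S"
    and x: "x \<in> S" "x \<noteq> 0" and irr: "\<And>y z. y \<in> S - {0} \<Longrightarrow> z \<in> S - {0} \<Longrightarrow> x \<noteq> y + z"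
  shows "x \<in> A"
proof (rule ccontr)
  assume "x \<notin> A"
  then have "A \<subseteq> S - {x}"
    using gen hull_subset[of A add_submonoid] by auto
  moreover have "add_submonoid (S - {x})"
    unfolding add_submonoid_def
  proof (intro conjI ballI)
    show "0 \<in> S - {x}" using S x by (simp add: add_submonoid_zero)
  next
    fix y z assume yz: "y \<in> S - {x}" "z \<in> S - {x}"
    \<comment> \<open>Irreducibility covers nonzero \<open>y\<close> and \<open>z\<close>; if one of
      them is 0, the sum is the other one, which differs from \<open>x\<close>.\<close>
    then have "y + z \<noteq> x"
      using irr[of y z] by (cases "y = 0"; cases "z = 0") auto
    with yz show "y + z \<in> S - {x}" using S by (simp add: add_submonoid_add)
  qed
  ultimately have "add_submonoid hull A \<subseteq> S - {x}" by (rule hull_minimal)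
  with gen x show False by auto
qed

lemma minimal_generating_set_not_redundant:
  assumes "is_minimal_generating_set A S" and "x \<in> A"
  shows "x \<notin> add_submonoid hull (A - {x})"
proof
  assume x: "x \<in> add_submonoid hull (A - {x})"
  have "A - {x} \<subseteq> add_submonoid hull (A - {x})" by (rule hull_subset)
  with x have "A \<subseteq> add_submonoid hull (A - {x})" by auto
  then have "add_submonoid hull A \<subseteq> add_submonoid hull (A - {x})"
    using add_submonoid_hull by (rule hull_minimal)
  moreover have "add_submonoid hull (A - {x}) \<subseteq> add_submonoid hull A"
    by (rule hull_mono) auto
  ultimately have "add_submonoid hull (A - {x}) = S"
    using assms(1) by (simp add: is_minimal_generating_set_def)
  moreover have "A - {x} \<subset> A" using assms(2) by auto
  ultimately show False using assms(1) by (simp add: is_minimal_generating_set_def)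
qed

text \<open>A sum of naturals is at least each of its summands, so \<open>x\<close> cannot occur in
  an expression of a smaller \<open>w\<close> by generators.\<close>

lemma generated_without_larger:
  assumes "w \<in> add_submonoid hull A" and "w < x"
  shows "w \<in> add_submonoid hull (A - {x})"
proof -
  let ?H = "add_submonoid hull (A - {x})"
  \<comment> \<open>The implication makes this set a submonoid: a sum below \<open>x\<close> has
    both summands below \<open>x\<close>. The generator \<open>x\<close> lies in it
    vacuously.\<close>
  have "add_submonoid {w. w < x \<longrightarrow> w \<in> ?H}"
    using add_submonoid_hull[of "A - {x}"] unfolding add_submonoid_def[of "{w. _ w}"]
    by (auto intro: add_submonoid_zero add_submonoid_add)
  moreover have "A \<subseteq> {w. w < x \<longrightarrow> w \<in> ?H}"
    by (auto intro: hull_inc)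
  ultimately have "add_submonoid hull A \<subseteq> {w. w < x \<longrightarrow> w \<in> ?H}"
    by (intro hull_minimal)
  with assms show ?thesis by auto
qed

text \<open>If \<open>x = y + z\<close> with nonzero summands, both are smaller than
  \<open>x\<close>, hence generated without \<open>x\<close>, and \<open>x\<close> would be
  redundant. Conversely, every generating set contains all irreducible elements.\<close>

lemma minimal_generators_iff:
  assumes S: "add_submonoid S"
  shows "x \<in> minimal_generators S \<longleftrightarrow>
    x \<in> S \<and> x \<noteq> 0 \<and> (\<forall>y\<in>S - {0}. \<forall>z\<in>S - {0}. x \<noteq> y + z)"
proof -
  let ?G = "minimal_generators S"
  have min: "is_minimal_generating_set ?G S"
    unfolding minimal_generators_def by (rule theI'[OF ex1_minimal_generating_set[OF S]])
  then have gen: "add_submonoid hull ?G = S"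
    by (simp add: is_minimal_generating_set_def)
  show ?thesis
  proof (intro iffI conjI ballI)
    assume x: "x \<in> ?G"
    note irredundant = minimal_generating_set_not_redundant[OF min x]
    show "x \<in> S" using x gen hull_inc[of x ?G] by auto
    show "x \<noteq> 0" using irredundant add_submonoid_zero[OF add_submonoid_hull] by metis
    fix y z assume yz: "y \<in> S - {0}" "z \<in> S - {0}"
    show "x \<noteq> y + z"
    proof
      assume e: "x = y + z"
      with yz have "y \<in> add_submonoid hull (?G - {x})" "z \<in> add_submonoid hull (?G - {x})"
        by (auto intro!: generated_without_larger simp: gen)
      then have "x \<in> add_submonoid hull (?G - {x})"
        unfolding e by (rule add_submonoid_add[OF add_submonoid_hull])
      with irredundant show False by simp
    qed
  next
    assume "x \<in> S \<and> x \<noteq> 0 \<and> (\<forall>y\<in>S - {0}. \<forall>z\<in>S - {0}. x \<noteq> y + z)"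
    then show "x \<in> ?G"
      by (intro irreducible_in_generating_set[OF S gen]) auto
  qed
qed

text \<open>Turns the set excluded in the theorem into the sums of two nonzero elements, the form in
  which it is used below.\<close>

lemma reducible_iff:
  assumes "add_submonoid S"
  shows "x \<in> S - (minimal_generators S \<union> {0}) \<longleftrightarrow> (\<exists>y\<in>S - {0}. \<exists>z\<in>S - {0}. x = y + z)"
    (is "_ \<longleftrightarrow> ?red")
proof -
  have "x \<in> S \<and> x \<noteq> 0" if ?red
    using that assms by (elim bexE) (simp add: add_submonoid_add)
  moreover have "x \<in> minimal_generators S \<longleftrightarrow> x \<in> S \<and> x \<noteq> 0 \<and> \<not> ?red"
    unfolding minimal_generators_iff[OF assms] by simp
  ultimately show ?thesis
    unfolding Diff_iff Un_iff singleton_iff by argo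
qed

lemma add_submonoid_dilatation:
  assumes "add_submonoid S" and "a \<in> S"
  shows "add_submonoid (dilatation S a)"
  unfolding add_submonoid_def
proof (intro conjI ballI)
  show "0 \<in> dilatation S a" by (simp add: dilatation_def)
next
  fix x y assume xy: "x \<in> dilatation S a" "y \<in> dilatation S a"
  show "x + y \<in> dilatation S a"
  proof (cases "x = 0 \<or> y = 0")
    case True
    with xy show ?thesis by auto
  next
    case False
    with xy obtain s t where st: "s \<in> S - {0}" "t \<in> S - {0}" "x = s + a" "y = t + a"
      by (auto simp: dilatation_def)
    \<comment> \<open>One of the two shifts is absorbed into the element of \<open>S\<close>, which
      is possible because \<open>a \<in> S\<close>.\<close>
    then have "x + y = (s + t + a) + a" "s + t + a \<in> S - {0}"
      using assms by (simp_all add: add_submonoid_add)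
    then show ?thesis unfolding dilatation_def by blast
  qed
qed

text \<open>Cancelling \<open>2 * a\<close> in \<open>s + a = (y + a) + (z + a)\<close> leaves
  \<open>s - a = y + z\<close>. What remains for the theorem is to sort the admissible
  \<open>s\<close> by means of Apery sets.\<close>

lemma minimal_generators_dilatation:
  assumes S: "add_submonoid S" and a: "a \<in> S"
  shows "minimal_generators (dilatation S a) =
    {s + a | s. s \<in> S - {0} \<and> int s - int a \<notin> int ` (S - (minimal_generators S \<union> {0}))}"
proof -
  have nz: "dilatation S a - {0} = (\<lambda>s. s + a) ` (S - {0})"
    by (auto simp: dilatation_def)
  have red: "int s - int a \<in> int ` (S - (minimal_generators S \<union> {0})) \<longleftrightarrow>
      (\<exists>u\<in>dilatation S a - {0}. \<exists>v\<in>dilatation S a - {0}. s + a = u + v)" for s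
  proof -
    have "int s - int a \<in> int ` (S - (minimal_generators S \<union> {0})) \<longleftrightarrow>
        (\<exists>w. s = w + a \<and> w \<in> S - (minimal_generators S \<union> {0}))"
    proof -
      \<comment> \<open>Since \<open>int w\<close> is nonnegative, the integer difference can be
        replaced by an equation in the naturals.\<close>
      have "int s - int a = int w \<longleftrightarrow> s = w + a" for w by linarith
      then show ?thesis unfolding image_iff by blast
    qed
    also have "\<dots> \<longleftrightarrow> (\<exists>y\<in>S - {0}. \<exists>z\<in>S - {0}. s = y + z + a)"
      unfolding reducible_iff[OF S] by blast
    also have "\<dots> \<longleftrightarrow> (\<exists>u\<in>dilatation S a - {0}. \<exists>v\<in>dilatation S a - {0}. s + a = u + v)"
      unfolding nz by (simp add: algebra_simps)
    finally show ?thesis .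
  qed
  have gen: "x \<in> minimal_generators (dilatation S a) \<longleftrightarrow> x \<in> dilatation S a - {0} \<and>
      \<not> (\<exists>u\<in>dilatation S a - {0}. \<exists>v\<in>dilatation S a - {0}. x = u + v)" for x
    unfolding minimal_generators_iff[OF add_submonoid_dilatation[OF S a]] by simp
  show ?thesis
  proof (intro set_eqI)
    fix x
    have "x \<in> dilatation S a - {0} \<longleftrightarrow> (\<exists>s. x = s + a \<and> s \<in> S - {0})"
      unfolding nz by blast
    then show "x \<in> minimal_generators (dilatation S a) \<longleftrightarrow> x \<in> {s + a | s. s \<in> S - {0} \<and>
        int s - int a \<notin> int ` (S - (minimal_generators S \<union> {0}))}"
      unfolding gen red mem_Collect_eq by metis
  qed
qed

lemma not_in_AperyE:
  assumes "x \<in> S" and "x \<notin> Apery S s"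
  obtains y where "y \<in> S" and "x = y + s"
proof -
  obtain y where "y \<in> S" "int x - int s = int y"
    using assms by (auto simp: Apery_def)
  then show ?thesis by (intro that[of y]) auto
qed

text \<open>A cofinite set of naturals has a nonzero element, so the \<open>LEAST\<close> in the
  definition is attained.\<close>

lemma semigroup_mult_in:
  assumes "numerical_semigroup S"
  shows "semigroup_mult S \<in> S" and "0 < semigroup_mult S"
proof -
  have "infinite (S - {0})"
  proof
    assume "finite (S - {0})"
    moreover have "finite (UNIV - S)"
      using assms by (simp add: numerical_semigroup_def)
    ultimately have "finite (insert 0 (S - {0} \<union> (UNIV - S)))" by simp
    moreover have "insert 0 (S - {0} \<union> (UNIV - S)) = UNIV" by auto
    ultimately show False by simp
  qed
  then have "S - {0} \<noteq> {}" by (rule infinite_imp_nonempty)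
  then obtain n where "n \<in> S - {0}" by blast
  then have "n \<in> S \<and> 0 < n" by simp
  then have "semigroup_mult S \<in> S \<and> 0 < semigroup_mult S"
    unfolding semigroup_mult_def by (rule LeastI)
  then show "semigroup_mult S \<in> S" "0 < semigroup_mult S" by auto
qed

lemma semigroup_mult_le: "n \<in> S \<Longrightarrow> 0 < n \<Longrightarrow> semigroup_mult S \<le> n"
  unfolding semigroup_mult_def by (rule Least_le) simp

theorem corollary2p4:
  fixes S :: "nat set" and a :: nat
  assumes "numerical_semigroup S" and "S \<noteq> UNIV" and "a \<in> S"
  shows "minimal_generators (dilatation S a) =
    {semigroup_mult S + 2 * a} \<union>
    {\<alpha> + a | \<alpha>. \<alpha> \<in> Apery S (semigroup_mult S) - {0} \<and>
       int \<alpha> - int a \<notin> int ` (S - (minimal_generators S \<union> {0}))} \<union>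
    {\<beta> + semigroup_mult S + a | \<beta>. \<beta> \<in> Apery S a \<and>
       int \<beta> + int (semigroup_mult S) - int a \<notin> int ` (S - (minimal_generators S \<union> {0}))}"
    (is "_ = {?e + 2 * a} \<union> ?A \<union> ?B")
proof -
  let ?R = "S - (minimal_generators S \<union> {0})"
  have S: "add_submonoid S" using assms(1) by (simp add: numerical_semigroup_def)
  note e = semigroup_mult_in[OF assms(1)]
  \<comment> \<open>In \<open>?e = y + z\<close> with nonzero summands, \<open>y\<close> would be a
    positive element of \<open>S\<close> below the least one.\<close>
  have e_irr: "?e \<notin> ?R"
  proof
    assume "?e \<in> ?R"
    then obtain y z where yz: "y \<in> S - {0}" "z \<in> S - {0}" "?e = y + z"
      unfolding reducible_iff[OF S] by blast
    then have "?e \<le> y" by (intro semigroup_mult_le) auto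
    with yz show False by simp
  qed
  have "{s + a | s. s \<in> S - {0} \<and> int s - int a \<notin> int ` ?R} = {?e + 2 * a} \<union> ?A \<union> ?B"
  proof (intro equalityI subsetI)
    fix x assume "x \<in> {s + a | s. s \<in> S - {0} \<and> int s - int a \<notin> int ` ?R}"
    then obtain s where s: "x = s + a" "s \<in> S - {0}" "int s - int a \<notin> int ` ?R" by blast
    show "x \<in> {?e + 2 * a} \<union> ?A \<union> ?B"
    proof (cases "s \<in> Apery S ?e")
      case True
      with s have "x \<in> ?A" by blast
      then show ?thesis by blast
    next
      case False
      with s obtain b where b: "b \<in> S" "s = b + ?e" by (auto elim: not_in_AperyE)
      show ?thesis
      proof (cases "b \<in> Apery S a")
        case True
        moreover have "x = b + ?e + a" "int b + int ?e - int a \<notin> int ` ?R"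
          using s b by auto
        ultimately have "x \<in> ?B" by blast
        then show ?thesis by blast
      next
        case False
        with b obtain c where c: "c \<in> S" "b = c + a" by (auto elim: not_in_AperyE)
        \<comment> \<open>Here \<open>s = c + a + ?e\<close>. A nonzero \<open>c\<close> would make
          \<open>s - a\<close> reducible; \<open>c = 0\<close> gives the isolated generator
          \<open>?e + 2 * a\<close>. For \<open>a = 0\<close> the set \<open>Apery S a\<close> is
          empty, so every \<open>b\<close> ends up in this case.\<close>
        have "int s - int a = int (c + ?e)" using b c by simp
        with s have "c + ?e \<notin> ?R" by (metis imageI)
        moreover have "?e \<in> S - {0}" using e by simp
        ultimately have "c = 0" using c unfolding reducible_iff[OF S] by blast
        with b c s show ?thesis by simp
      qed
    qed
  next
    fix x assume "x \<in> {?e + 2 * a} \<union> ?A \<union> ?B"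
    then consider "x = ?e + 2 * a" | "x \<in> ?A" | "x \<in> ?B" by blast
    then have "\<exists>s. x = s + a \<and> s \<in> S - {0} \<and> int s - int a \<notin> int ` ?R"
    proof cases
      case 1
      \<comment> \<open>The witness is \<open>s = ?e + a\<close>, for which \<open>s - a\<close> is
        the irreducible element \<open>?e\<close>.\<close>
      have "int (?e + a) - int a \<notin> int ` ?R" using e_irr by auto
      moreover have "?e + a \<in> S - {0}" using e assms(3) S by (simp add: add_submonoid_add)
      ultimately show ?thesis using 1 by (intro exI[of _ "?e + a"]) simp
    next
      case 2
      then show ?thesis by (auto simp: Apery_def)
    next
      case 3
      then obtain b where b: "x = b + ?e + a" "b \<in> Apery S a"
        "int b + int ?e - int a \<notin> int ` ?R" by blast
      moreover have "b + ?e \<in> S - {0}"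
        using b e S by (simp add: add_submonoid_add Apery_def)
      ultimately show ?thesis by (intro exI[of _ "b + ?e"]) simp
    qed
    then show "x \<in> {s + a | s. s \<in> S - {0} \<and> int s - int a \<notin> int ` ?R}" by blast
  qed
  with minimal_generators_dilatation[OF S assms(3)] show ?thesis by simp
qed

end
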